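(* Let $1<p\le\infty$ and $\alpha,\beta>0$. For $u\in L^1(\Omega)$, $\mathrm{TVL}^p_{\alpha,\beta}(u)<\infty$ if and only if $u\in \mathrm{BV}(\Omega)$. Moreover there exist constants $0<C_1,C_2<\infty$, independent of $u$, such that $$C_2\|Du\|_{\mathcal M}\le \mathrm{TVL}^p_{\alpha,\beta}(u)\le C_1\|Du\|_{\mathcal M}.$$
   Context: $\Omega\subset\mathbb{R}^d$ is an open, bounded set with Lipschitz boundary. For $u\in L^1(\Omega)$, $$\mathrm{TVL}^p_{\alpha,\beta}(u)=\inf_{w\in L^p(\Omega)}\alpha\|Du-w\|_{\mathcal M}+\beta\|w\|_{L^p(\Omega)}\in[0,+\infty],$$ where $w$ is $\mathbb{R}^d$-valued, $\|w\|_{L^p(\Omega)}$ is the $L^p$ norm of the pointwise Euclidean norm $|w|$, $Du$ is the distributional derivative, and for an $\mathbb{R}^d$-valued distribution $\mathcal T$ on $\Omega$, $\|\mathcal T\|_{\mathcal M}=\sup\{\langle \mathcal T,\phi\rangle:\phi\in C_c^\infty(\Omega,\mathbb{R}^d),\ \|\phi\|_\infty\le 1\}$ (equal to $|\mu|(\Omega)$ if $\mathcal T$ is a finite Radon measure $\mu$, and $+\infty$ otherwise). $\mathrm{BV}(\Omega)$ is the set of $u\in L^1(\Omega)$ with $\|Du\|_{\mathcal M}<\infty$. *)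

theory Defs
  imports "HOL-Probability.Essential_Supremum"
begin

(* Near every boundary point the set lies, within a ball, on one side of the graph of a Lipschitz
   function.  nu is the graph direction, g a function on the hyperplane orthogonal to nu and
   y - (y \<bullet> nu) nu the projection of y to that hyperplane, so choosing nu amounts to
   choosing a rotated coordinate system. *)
definition lipschitz_boundary :: "'a::euclidean_space set \<Rightarrow> bool" where
  "lipschitz_boundary \<Omega> \<longleftrightarrow>
     (\<forall>x\<in>frontier \<Omega>. \<exists>r>0. \<exists>\<nu>. norm \<nu> = 1 \<and>
        (\<exists>(g :: 'a \<Rightarrow> real) L. L-lipschitz_on {z. z \<bullet> \<nu> = 0} g \<and>
           \<Omega> \<inter> ball x r = {y \<in> ball x r. y \<bullet> \<nu> < g (y - (y \<bullet> \<nu>) *\<^sub>R \<nu>)}))"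

primrec C_k :: "nat \<Rightarrow> ('a::euclidean_space \<Rightarrow> 'b::real_normed_vector) \<Rightarrow> bool" where
  "C_k 0 f \<longleftrightarrow> continuous_on UNIV f"
| "C_k (Suc k) f \<longleftrightarrow> f differentiable_on UNIV \<and>
     (\<forall>b\<in>Basis. C_k k (\<lambda>x. frechet_derivative f (at x) b))"

(* Compactly supported smooth functions on \<Omega> are identified with their extensions by zero. *)
definition test_functions :: "'a::euclidean_space set \<Rightarrow> ('a \<Rightarrow> 'b::real_normed_vector) set" where
  "test_functions \<Omega> = {\<phi>. (\<forall>k. C_k k \<phi>) \<and>
     compact (closure {x. \<phi> x \<noteq> 0}) \<and> closure {x. \<phi> x \<noteq> 0} \<subseteq> \<Omega>}"

definition divergence :: "('a::euclidean_space \<Rightarrow> 'a) \<Rightarrow> 'a \<Rightarrow> real" where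
  "divergence \<phi> x = (\<Sum>b\<in>Basis. frechet_derivative \<phi> (at x) b \<bullet> b)"

(* Vector-valued distributions are represented by their action on vector fields. *)
definition distr_gradient ::
    "'a::euclidean_space set \<Rightarrow> ('a \<Rightarrow> real) \<Rightarrow> ('a \<Rightarrow> 'a) \<Rightarrow> real" where
  "distr_gradient \<Omega> u = (\<lambda>\<phi>. - (\<integral>x. u x * divergence \<phi> x \<partial>lebesgue_on \<Omega>))"

definition regular_distr ::
    "'a::euclidean_space set \<Rightarrow> ('a \<Rightarrow> 'a) \<Rightarrow> ('a \<Rightarrow> 'a) \<Rightarrow> real" where
  "regular_distr \<Omega> w = (\<lambda>\<phi>. \<integral>x. w x \<bullet> \<phi> x \<partial>lebesgue_on \<Omega>)"

(* The supremum is taken in the extended reals.  It is nonnegative for every distribution, since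
   \<phi> = 0 is admissible, so the conversion to ennreal loses nothing. *)
definition mass_norm :: "'a::euclidean_space set \<Rightarrow> (('a \<Rightarrow> 'a) \<Rightarrow> real) \<Rightarrow> ennreal" where
  "mass_norm \<Omega> T =
     e2ennreal (SUP \<phi>\<in>{\<phi> \<in> test_functions \<Omega>. \<forall>x. norm (\<phi> x) \<le> 1}. ereal (T \<phi>))"

definition Lp_norm :: "'a measure \<Rightarrow> ennreal \<Rightarrow> ('a \<Rightarrow> 'b::real_normed_vector) \<Rightarrow> ennreal" where
  "Lp_norm M p f =
     (if p = \<infinity> then esssup M (\<lambda>x. ennreal (norm (f x)))
      else let I = (\<integral>\<^sup>+x. ennreal (norm (f x) powr enn2real p) \<partial>M)
           in if I = \<infinity> then \<infinity> else ennreal (enn2real I powr (1 / enn2real p)))"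

definition Lp_space :: "'a measure \<Rightarrow> ennreal \<Rightarrow> ('a \<Rightarrow> 'b::real_normed_vector) set" where
  "Lp_space M p = {f \<in> borel_measurable M. Lp_norm M p f < \<infinity>}"

definition BV :: "'a::euclidean_space set \<Rightarrow> ('a \<Rightarrow> real) set" where
  "BV \<Omega> = {u. integrable (lebesgue_on \<Omega>) u \<and> mass_norm \<Omega> (distr_gradient \<Omega> u) < \<infinity>}"

definition TVL ::
    "'a::euclidean_space set \<Rightarrow> ennreal \<Rightarrow> real \<Rightarrow> real \<Rightarrow> ('a \<Rightarrow> real) \<Rightarrow> ennreal" where
  "TVL \<Omega> p \<alpha> \<beta> u =
     (INF w\<in>Lp_space (lebesgue_on \<Omega>) p.
        ennreal \<alpha> * mass_norm \<Omega> (\<lambda>\<phi>. distr_gradient \<Omega> u \<phi> - regular_distr \<Omega> w \<phi>)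
        + ennreal \<beta> * Lp_norm (lebesgue_on \<Omega>) p w)"

end

theory Submission
  imports Defs
begin

text \<open>The upper bound is the competitor \<open>w = 0\<close>. For the lower bound, \<open>\<Omega>\<close> has finite measure, so
  \<open>\<parallel>w\<parallel>\<^sub>1 \<le> (|\<Omega>| + 1) \<parallel>w\<parallel>\<^sub>p\<close>, and the triangle inequality
  \<open>\<parallel>Du\<parallel> \<le> \<parallel>Du - w\<parallel> + \<parallel>w\<parallel>\<^sub>1\<close> holds for every competitor \<open>w\<close>.\<close>

text \<open>Instead of Hoelder's inequality with its factor
  \<open>measure M (space M) powr (1 - 1/p)\<close>, a pointwise bound of \<open>norm (f x)\<close>
  by a constant plus a multiple of its \<open>q\<close>-th power is integrated. The constant is
  cruder, but no conjugate exponent appears and one factor serves every \<open>p\<close>.\<close>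

lemma (in finite_measure) nn_integral_norm_le_Lp_norm:
  fixes f :: "'a \<Rightarrow> 'b::real_normed_vector"
  assumes [measurable]: "f \<in> borel_measurable M" and p: "1 < p"
  shows "(\<integral>\<^sup>+x. ennreal (norm (f x)) \<partial>M) \<le> ennreal (measure M (space M) + 1) * Lp_norm M p f"
proof (cases "p = \<infinity>")
  case True
  define N where "N = Lp_norm M p f"
  have "N = esssup M (\<lambda>x. ennreal (norm (f x)))"
    by (simp add: N_def Lp_norm_def True)
  then have "AE x in M. ennreal (norm (f x)) \<le> N"
    by (simp add: esssup_AE)
  then have "(\<integral>\<^sup>+x. ennreal (norm (f x)) \<partial>M) \<le> (\<integral>\<^sup>+x. N \<partial>M)"
    by (rule nn_integral_mono_AE)
  also have "\<dots> = ennreal (measure M (space M)) * N"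
    by (simp add: emeasure_eq_measure mult.commute)
  also have "\<dots> \<le> ennreal (measure M (space M) + 1) * N"
    by (intro mult_right_mono ennreal_leI) auto
  finally show ?thesis by (simp add: N_def)
next
  case False
  define q where "q = enn2real p"
  define I where "I = (\<integral>\<^sup>+x. ennreal (norm (f x) powr q) \<partial>M)"
  have q: "1 < q"
    using p False unfolding q_def by (cases p) auto
  show ?thesis
  proof (cases "I = \<infinity>")
    case True
    \<comment> \<open>The summand 1 makes the factor strictly positive, so its product with the
      infinite norm is infinite.\<close>
    then show ?thesis
      using False by (simp add: Lp_norm_def I_def q_def ennreal_mult_top add_nonneg_pos)
  next
    case finite_I: False
    define i where "i = enn2real I"
    define n where "n = i powr (1 / q)"
    have i: "I = ennreal i" "0 \<le> i"
      using finite_I by (simp_all add: i_def less_top)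
    have norm_eq: "Lp_norm M p f = ennreal n"
      using False finite_I by (simp add: Lp_norm_def I_def q_def i_def n_def Let_def)
    \<comment> \<open>The scaling by \<open>n\<close> below divides by \<open>n\<close> and
      \<open>i\<close>, so the case of an almost everywhere vanishing \<open>f\<close> is split
      off.\<close>
    show ?thesis
    proof (cases "i = 0")
      case True
      then have "(\<integral>\<^sup>+x. ennreal (norm (f x) powr q) \<partial>M) = 0"
        using i by (simp add: I_def)
      then have "AE x in M. ennreal (norm (f x) powr q) = 0"
        by (subst nn_integral_0_iff_AE[symmetric]) auto
      then have "AE x in M. ennreal (norm (f x)) = 0"
        by eventually_elim (simp add: ennreal_eq_0_iff)
      then have "(\<integral>\<^sup>+x. ennreal (norm (f x)) \<partial>M) = 0"
        by (subst nn_integral_0_iff_AE) auto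
      then show ?thesis by simp
    next
      case False
      with i have i0: "0 < i" by simp
      then have n0: "0 < n" by (simp add: n_def)
      have npow: "n powr q = i"
        using q i0 by (simp add: n_def powr_powr)
      \<comment> \<open>\<open>s \<le> 1 + s\<^sup>q\<close> at \<open>s = t / n\<close>\<close>
      have le: "t \<le> n + n / i * t powr q" if t: "0 \<le> t" for t
      proof (cases "t \<le> n")
        case True
        then show ?thesis using n0 i0 by (simp add: add_increasing2)
      next
        case False
        then have "t / n \<le> (t / n) powr q"
          using q n0 powr_mono[of 1 q "t / n"] by simp
        also have "\<dots> = t powr q / i"
          using t n0 npow by (simp add: powr_divide)
        finally have "t \<le> n / i * t powr q"
          using n0 by (simp add: field_simps)
        then show ?thesis using n0 by simp
      qed
      \<comment> \<open>Since \<open>I = i\<close>, the second term integrates to exactly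
        \<open>n\<close>; this is the origin of the 1 in the factor.\<close>
      have "(\<integral>\<^sup>+x. ennreal (norm (f x)) \<partial>M)
          \<le> (\<integral>\<^sup>+x. ennreal n + ennreal (n / i) * ennreal (norm (f x) powr q) \<partial>M)"
        using le n0 i0 by (intro nn_integral_mono)
          (simp add: ennreal_mult[symmetric] ennreal_plus[symmetric] del: ennreal_plus)
      also have "\<dots> = ennreal n * ennreal (measure M (space M)) + ennreal (n / i) * I"
        by (simp add: nn_integral_add nn_integral_cmult I_def emeasure_eq_measure)
      also have "\<dots> = ennreal (measure M (space M) + 1) * ennreal n"
        using n0 i0 i by (simp add: ennreal_mult[symmetric] ennreal_plus[symmetric] field_simps
            del: ennreal_plus)
      finally show ?thesis by (simp add: norm_eq)
    qed
  qed
qed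

text \<open>For finite \<open>p\<close> all powers vanish because \<open>0 powr a = 0\<close> for
  every real \<open>a\<close>, even \<open>a = 0\<close>.\<close>

lemma Lp_norm_zero:
  fixes p :: ennreal
  shows "Lp_norm M p (\<lambda>x. 0 :: 'b::real_normed_vector) = 0"
proof -
  have "esssup M (\<lambda>x. 0 :: ennreal) \<le> 0"
    by (rule esssup_I) auto
  then show ?thesis by (simp add: Lp_norm_def)
qed

lemma le_mass_norm:
  assumes "\<phi> \<in> test_functions \<Omega>" and "\<And>x. norm (\<phi> x) \<le> 1"
  shows "ennreal (T \<phi>) \<le> mass_norm \<Omega> T"
  unfolding mass_norm_def e2ennreal_ereal[symmetric]
  using assms by (intro e2ennreal_mono SUP_upper) simp

text \<open>Together with \<open>le_mass_norm\<close> this lets the mass norm be handled as a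
  supremum in \<open>ennreal\<close>. Truncating negative values of \<open>T \<phi>\<close> to 0 is
  harmless, since \<open>B\<close> is nonnegative and bounds them anyway.\<close>

lemma mass_norm_least:
  assumes "\<And>\<phi>. \<phi> \<in> test_functions \<Omega> \<Longrightarrow> (\<And>x. norm (\<phi> x) \<le> 1) \<Longrightarrow> ennreal (T \<phi>) \<le> B"
  shows "mass_norm \<Omega> T \<le> B"
proof -
  have "ereal (T \<phi>) \<le> enn2ereal B"
    if "\<phi> \<in> test_functions \<Omega>" "\<forall>x. norm (\<phi> x) \<le> 1" for \<phi>
  proof -
    have "ereal (T \<phi>) \<le> enn2ereal (ennreal (T \<phi>))"
      by (cases "0 \<le> T \<phi>") (auto simp: ennreal_neg intro: order_trans[OF _ enn2ereal_nonneg])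
    also have "\<dots> \<le> enn2ereal B"
      using assms[of \<phi>] that by (simp add: less_eq_ennreal.rep_eq)
    finally show ?thesis .
  qed
  then have "(SUP \<phi>\<in>{\<phi> \<in> test_functions \<Omega>. \<forall>x. norm (\<phi> x) \<le> 1}. ereal (T \<phi>)) \<le> enn2ereal B"
    by (intro SUP_least) auto
  then show ?thesis
    unfolding mass_norm_def using e2ennreal_mono by fastforce
qed

lemma regular_distr_le:
  assumes "\<And>x. norm (\<phi> x) \<le> 1"
  shows "ennreal (regular_distr \<Omega> w \<phi>) \<le> (\<integral>\<^sup>+x. ennreal (norm (w x)) \<partial>lebesgue_on \<Omega>)"
proof (cases "integrable (lebesgue_on \<Omega>) (\<lambda>x. w x \<bullet> \<phi> x)")
  case True
  have "ennreal (regular_distr \<Omega> w \<phi>) \<le> ennreal (norm (regular_distr \<Omega> w \<phi>))"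
    by (intro ennreal_leI) simp
  also have "\<dots> \<le> (\<integral>\<^sup>+x. ennreal (norm (w x \<bullet> \<phi> x)) \<partial>lebesgue_on \<Omega>)"
    unfolding regular_distr_def using True by (rule integral_norm_bound_ennreal)
  also have "\<dots> \<le> (\<integral>\<^sup>+x. ennreal (norm (w x)) \<partial>lebesgue_on \<Omega>)"
  proof (intro nn_integral_mono ennreal_leI)
    fix x
    have "norm (w x \<bullet> \<phi> x) \<le> norm (w x) * norm (\<phi> x)"
      by (simp add: Cauchy_Schwarz_ineq2)
    also have "\<dots> \<le> norm (w x)"
      using assms by (simp add: mult_left_le)
    finally show "norm (w x \<bullet> \<phi> x) \<le> norm (w x)" .
  qed
  finally show ?thesis .
next
  case False
  \<comment> \<open>The Bochner integral of a non-integrable function is 0 by convention.\<close>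
  then show ?thesis by (simp add: regular_distr_def not_integrable_integral_eq)
qed

text \<open>The splitting is done for each test field separately, so \<open>T\<close> may be any
  functional. If \<open>w\<close> is not in L^1, the right-hand side is infinite.\<close>

lemma mass_norm_triangle:
  "mass_norm \<Omega> T \<le> mass_norm \<Omega> (\<lambda>\<phi>. T \<phi> - regular_distr \<Omega> w \<phi>)
     + (\<integral>\<^sup>+x. ennreal (norm (w x)) \<partial>lebesgue_on \<Omega>)"
proof (rule mass_norm_least)
  fix \<phi> :: "'a \<Rightarrow> 'a"
  assume \<phi>: "\<phi> \<in> test_functions \<Omega>" "\<And>x. norm (\<phi> x) \<le> 1"
  \<comment> \<open>\<open>ennreal\<close> is not additive on reals of mixed sign; passing to the
    positive parts of both summands yields the inequality.\<close>
  have "ennreal (T \<phi>) \<le> ennreal (T \<phi> - regular_distr \<Omega> w \<phi>) + ennreal (regular_distr \<Omega> w \<phi>)"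
    using ennreal_leI[of "T \<phi>" "max 0 (T \<phi> - regular_distr \<Omega> w \<phi>) + max 0 (regular_distr \<Omega> w \<phi>)"]
    by (simp add: ennreal_max_0)
  also have "\<dots> \<le> mass_norm \<Omega> (\<lambda>\<phi>. T \<phi> - regular_distr \<Omega> w \<phi>)
      + (\<integral>\<^sup>+x. ennreal (norm (w x)) \<partial>lebesgue_on \<Omega>)"
    using \<phi> by (intro add_mono le_mass_norm[of \<phi> \<Omega> "\<lambda>\<phi>. T \<phi> - regular_distr \<Omega> w \<phi>"] regular_distr_le)
  finally show "ennreal (T \<phi>) \<le> \<dots>" .
qed

lemma TVL_le_mass_norm: "TVL \<Omega> p \<alpha> \<beta> u \<le> ennreal \<alpha> * mass_norm \<Omega> (distr_gradient \<Omega> u)"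
proof -
  have "(\<lambda>x. 0) \<in> Lp_space (lebesgue_on \<Omega>) p"
    by (simp add: Lp_space_def Lp_norm_zero)
  then show ?thesis
    unfolding TVL_def by (rule INF_lower2) (simp add: regular_distr_def Lp_norm_zero)
qed

lemma mass_norm_le_TVL:
  assumes \<Omega>: "\<Omega> \<in> lmeasurable" and p: "1 < p" and "0 < \<alpha>" "0 < \<beta>"
  shows "ennreal (min \<alpha> (\<beta> / (measure lebesgue \<Omega> + 1))) * mass_norm \<Omega> (distr_gradient \<Omega> u)
    \<le> TVL \<Omega> p \<alpha> \<beta> u"
  unfolding TVL_def
proof (rule INF_greatest)
  fix w :: "'a \<Rightarrow> 'a"
  assume w: "w \<in> Lp_space (lebesgue_on \<Omega>) p"
  define K where "K = measure lebesgue \<Omega> + 1"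
  \<comment> \<open>The largest number with \<open>C \<le> \<alpha>\<close> and
    \<open>C * K \<le> \<beta>\<close>, which is what comparing \<open>C * (A + K * N)\<close>
    termwise with \<open>\<alpha> * A + \<beta> * N\<close> requires.\<close>
  define C where "C = min \<alpha> (\<beta> / K)"
  define A where "A = mass_norm \<Omega> (\<lambda>\<phi>. distr_gradient \<Omega> u \<phi> - regular_distr \<Omega> w \<phi>)"
  define N where "N = Lp_norm (lebesgue_on \<Omega>) p w"
  have K: "0 < K" by (simp add: K_def add_nonneg_pos)
  then have C: "0 < C" "C * K \<le> \<beta>" "C \<le> \<alpha>"
    using assms(3,4) by (auto simp: C_def min_def field_simps)
  interpret finite_measure "lebesgue_on \<Omega>"
    using \<Omega> by (rule finite_measure_lebesgue_on)
  have "measure (lebesgue_on \<Omega>) (space (lebesgue_on \<Omega>)) = measure lebesgue \<Omega>"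
    using \<Omega> by (simp add: measure_restrict_space fmeasurableD)
  then have "(\<integral>\<^sup>+x. ennreal (norm (w x)) \<partial>lebesgue_on \<Omega>) \<le> ennreal K * N"
    using nn_integral_norm_le_Lp_norm[of w p] w p by (simp add: Lp_space_def K_def N_def)
  then have "mass_norm \<Omega> (distr_gradient \<Omega> u) \<le> A + ennreal K * N"
    using mass_norm_triangle[of \<Omega> "distr_gradient \<Omega> u" w] unfolding A_def
    by (meson add_left_mono order_trans)
  then have "ennreal C * mass_norm \<Omega> (distr_gradient \<Omega> u) \<le> ennreal C * (A + ennreal K * N)"
    by (rule mult_left_mono) simp
  also have "\<dots> = ennreal C * A + ennreal (C * K) * N"
    using C K by (simp add: distrib_left ennreal_mult mult.assoc)
  also have "\<dots> \<le> ennreal \<alpha> * A + ennreal \<beta> * N"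
    using C by (intro add_mono mult_right_mono ennreal_leI) auto
  finally show "ennreal (min \<alpha> (\<beta> / (measure lebesgue \<Omega> + 1))) * mass_norm \<Omega> (distr_gradient \<Omega> u)
      \<le> ennreal \<alpha> * mass_norm \<Omega> (\<lambda>\<phi>. distr_gradient \<Omega> u \<phi> - regular_distr \<Omega> w \<phi>)
        + ennreal \<beta> * Lp_norm (lebesgue_on \<Omega>) p w"
    by (simp add: C_def K_def A_def N_def)
qed

theorem lemma2p4:
  fixes \<Omega> :: "(real ^ 'd) set" and p :: ennreal and \<alpha> \<beta> :: real
  assumes "open \<Omega>" and "bounded \<Omega>" and "lipschitz_boundary \<Omega>"
    and "1 < p" and "p \<le> \<infinity>" and "0 < \<alpha>" and "0 < \<beta>"
  shows "(\<forall>u. integrable (lebesgue_on \<Omega>) u \<longrightarrow> (TVL \<Omega> p \<alpha> \<beta> u < \<infinity> \<longleftrightarrow> u \<in> BV \<Omega>)) \<and>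
    (\<exists>C1 C2 :: real. 0 < C1 \<and> 0 < C2 \<and>
      (\<forall>u. integrable (lebesgue_on \<Omega>) u \<longrightarrow>
         ennreal C2 * mass_norm \<Omega> (distr_gradient \<Omega> u) \<le> TVL \<Omega> p \<alpha> \<beta> u \<and>
         TVL \<Omega> p \<alpha> \<beta> u \<le> ennreal C1 * mass_norm \<Omega> (distr_gradient \<Omega> u)))"
proof -
  define C where "C = min \<alpha> (\<beta> / (measure lebesgue \<Omega> + 1))"
  have C: "0 < C"
    using assms(6,7) by (simp add: C_def add_nonneg_pos)
  \<comment> \<open>Bounded open sets have finite Lebesgue measure, so \<open>C\<close> is a genuine
    constant determined by \<Omega>, \<alpha> and \<beta>.\<close>
  have "\<Omega> \<in> lmeasurable"
    using assms(1,2) by (simp add: lmeasurable_open)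
  then have lower: "ennreal C * mass_norm \<Omega> (distr_gradient \<Omega> u) \<le> TVL \<Omega> p \<alpha> \<beta> u" for u
    unfolding C_def using assms(4,6,7) by (rule mass_norm_le_TVL)
  have "TVL \<Omega> p \<alpha> \<beta> u < \<infinity> \<longleftrightarrow> u \<in> BV \<Omega>" if "integrable (lebesgue_on \<Omega>) u" for u
  proof
    assume "TVL \<Omega> p \<alpha> \<beta> u < \<infinity>"
    then have "ennreal C * mass_norm \<Omega> (distr_gradient \<Omega> u) < \<infinity>"
      using lower by (rule le_less_trans[rotated])
    \<comment> \<open>Positivity of \<open>C\<close> matters: in \<open>ennreal\<close>, 0 times
      infinity is 0, so a zero factor would hide an infinite mass norm.\<close>
    then show "u \<in> BV \<Omega>"
      using C that by (auto simp: BV_def ennreal_mult_less_top)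
  next
    assume "u \<in> BV \<Omega>"
    then have "ennreal \<alpha> * mass_norm \<Omega> (distr_gradient \<Omega> u) < \<infinity>"
      by (simp add: BV_def ennreal_mult_less_top)
    then show "TVL \<Omega> p \<alpha> \<beta> u < \<infinity>"
      using TVL_le_mass_norm by (rule le_less_trans[rotated])
  qed
  \<comment> \<open>The witnesses are \<open>C1 = \<alpha>\<close>, from the zero competitor, and
    \<open>C2 = C\<close>.\<close>
  then show ?thesis
    using assms(6) C lower TVL_le_mass_norm by blast
qed

end
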